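(* Let $q=2$, let $s\ge 2$ and $t\ge 2$ be integers, and put $m=s+t$. Let $\phi:\mathbb{F}_2^s\to\mathbb{F}_2^t$ and $g:\mathbb{F}_2^s\to\mathbb{F}_2$ be functions, and let $f:\mathbb{F}_2^m=\mathbb{F}_2^s\oplus\mathbb{F}_2^t\to\mathbb{F}_2$ be given by $f(\beta,\gamma)=\phi(\beta)\cdot\gamma+g(\beta)$ for $\beta\in\mathbb{F}_2^s$, $\gamma\in\mathbb{F}_2^t$. Let $U=\{\beta\in\mathbb{F}_2^s : \mathrm{wt}(\beta)\le 1\}$. Suppose that (1) $\phi$ is an injection from $U$ to $\mathbb{F}_2^t\setminus\{\mathbf{0}\}$ (i.e. the restriction of $\phi$ to $U$ is injective and takes values in $\mathbb{F}_2^t\setminus\{\mathbf{0}\}$), and $\phi(\beta)=\mathbf{0}$ for all $\beta$ with $\mathrm{wt}(\beta)=2$; (2) $g(\beta)=1$ for all $\beta\in\mathbb{F}_2^s$. Then $\mathcal{C}_f$ is a $[2^m-1,m+1]_2$ minimal linear code.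
   Context: $\mathrm{wt}$ denotes the Hamming weight (number of nonzero coordinates), and $\mathbf{x}\cdot\mathbf{y}=\sum_i x_iy_i$. For $f:\mathbb{F}_q^m\to\mathbb{F}_q$, $\mathcal{C}_f=\{(uf(\alpha)+\mathbf{v}\cdot\alpha)_{\alpha\in\mathbb{F}_q^m\setminus\{\mathbf{0}\}} : u\in\mathbb{F}_q,\ \mathbf{v}\in\mathbb{F}_q^m\}\subseteq\mathbb{F}_q^{q^m-1}$. An $[n,k]_q$ linear code is a $k$-dimensional subspace of $\mathbb{F}_q^n$. The support of a vector is the set of its coordinate positions with nonzero entry. A codeword $\mathbf{c}$ of a linear code $\mathcal{C}$ is minimal if every $\mathbf{b}\in\mathcal{C}$ whose support is contained in the support of $\mathbf{c}$ equals $a\mathbf{c}$ for some $a\in\mathbb{F}_q$; the code $\mathcal{C}$ is minimal if all of its codewords are minimal. *)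

theory Defs
  imports "HOL-Analysis.Analysis" "HOL-Library.Z2"
begin

instance bit :: finite
proof
  have "(UNIV :: bit set) \<subseteq> {0, 1}"
    using bit_not_one_iff by auto
  then show "finite (UNIV :: bit set)"
    by (rule finite_subset) simp
qed

text \<open>
  Vectors over a field \<open>'q\<close> with coordinate positions \<open>'n\<close> are elements of \<^typ>\<open>'q ^ 'n\<close>;
  subspaces and dimensions over \<open>'q\<close> are \<^const>\<open>vec.subspace\<close> and \<^const>\<open>vec.dim\<close>.
\<close>

definition supp :: "'q::zero ^ 'n \<Rightarrow> 'n set" where
  "supp x = {i. x $ i \<noteq> 0}"

definition wt :: "'q::zero ^ 'n \<Rightarrow> nat" where
  "wt x = card (supp x)"

definition dotp :: "'q::comm_semiring_0 ^ 'n \<Rightarrow> 'q ^ 'n \<Rightarrow> 'q" where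
  "dotp x y = (\<Sum>i\<in>UNIV. x $ i * y $ i)"

text \<open>The identification of \<open>\<F>\<^sup>s \<oplus> \<F>\<^sup>t\<close> with \<open>\<F>\<^sup>s\<^sup>+\<^sup>t\<close> by concatenation of coordinates.\<close>

definition join_vec :: "'q ^ 's \<Rightarrow> 'q ^ 't \<Rightarrow> 'q ^ ('s + 't)" where
  "join_vec \<beta> \<gamma> = (\<chi> k. case k of Inl i \<Rightarrow> \<beta> $ i | Inr j \<Rightarrow> \<gamma> $ j)"

text \<open>
  An \<open>[n,k]\<^sub>q\<close> linear code: the field and the length are carried by the types \<open>'q\<close> and \<open>'n\<close>, so the
  parameters \<open>q\<close> and \<open>n\<close> are recovered as their cardinalities.
\<close>

definition linear_code :: "nat \<Rightarrow> nat \<Rightarrow> nat \<Rightarrow> ('q::field ^ 'n) set \<Rightarrow> bool" where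
  "linear_code n k q C \<longleftrightarrow>
     CARD('q) = q \<and> CARD('n) = n \<and> vec.subspace C \<and> vec.dim C = k"

definition minimal_codeword :: "('q::field ^ 'n) set \<Rightarrow> 'q ^ 'n \<Rightarrow> bool" where
  "minimal_codeword C c \<longleftrightarrow>
     c \<in> C \<and> (\<forall>b\<in>C. supp b \<subseteq> supp c \<longrightarrow> (\<exists>a. b = a *s c))"

definition minimal_code :: "('q::field ^ 'n) set \<Rightarrow> bool" where
  "minimal_code C \<longleftrightarrow> (\<forall>c\<in>C. minimal_codeword C c)"

text \<open>
  The coordinate positions of \<open>\<C>\<^sub>f\<close> are the nonzero vectors of \<open>\<F>\<^sub>q\<^sup>m\<close>. They are made into
  a type of their own, so that \<open>\<C>\<^sub>f\<close> lives in a space of dimension exactly \<open>q\<^sup>m - 1\<close>.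
\<close>

typedef (overloaded) ('q, 'm) nonzero_vec = "{\<alpha> :: 'q::zero_neq_one ^ 'm. \<alpha> \<noteq> 0}"
  morphisms vec_of nonzero_vec_of
proof
  show "(\<chi> i. 1) \<in> {\<alpha> :: 'q ^ 'm. \<alpha> \<noteq> 0}"
    by (simp add: vec_eq_iff)
qed

instance nonzero_vec :: ("{finite, zero_neq_one}", finite) finite
proof
  have "finite (range (vec_of :: ('a, 'b) nonzero_vec \<Rightarrow> 'a ^ 'b))"
    by simp
  then show "finite (UNIV :: ('a, 'b) nonzero_vec set)"
    by (rule finite_imageD) (simp add: inj_on_def vec_of_inject)
qed

definition code_of ::
  "('q::{field, finite} ^ 'm::finite \<Rightarrow> 'q) \<Rightarrow> ('q ^ ('q, 'm) nonzero_vec) set" where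
  "code_of f = {(\<chi> \<alpha>. u * f (vec_of \<alpha>) + dotp v (vec_of \<alpha>)) | u v. True}"

end

theory Submission
  imports Defs
begin

text \<open>
  Over \<open>\<F>\<^sub>2\<close>, minimality says that among distinct nonzero functions \<open>u f + v\<close> no support contains
  another. An inclusion of supports amounts to an identity on the points where a linear form
  \<open>w = (w\<^sub>1, w\<^sub>2)\<close> takes a fixed value. With \<open>\<beta>\<close> held fixed, the identity makes the linear form
  \<open>\<phi> \<beta> - v\<^sub>2\<close> constant on an affine hyperplane with normal \<open>w\<^sub>2\<close>, so \<open>\<phi> \<beta> - v\<^sub>2\<close> is \<open>0\<close> or \<open>w\<^sub>2\<close>.
  That is incompatible with the distinct nonzero values of \<open>\<phi>\<close> on the vectors of weight at most
  one and the value \<open>0\<close> on those of weight two.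
\<close>

text \<open>These simp rules rewrite field operations to bitwise ones, where the ring lemmas no longer apply.\<close>

declare add_bit_eq_xor [simp del] mult_bit_eq_and [simp del]

section \<open>Dot products\<close>

lemma dotp_zero_left [simp]: "dotp 0 y = 0"
  and dotp_zero_right [simp]: "dotp x 0 = 0"
  by (simp_all add: dotp_def)

lemma dotp_add_right: "dotp z (x + y) = dotp z x + dotp z y"
  by (simp add: dotp_def algebra_simps sum.distrib)

lemma dotp_diff_left: "dotp (x - y) z = dotp x z - dotp y z"
  for x y z :: "'q::comm_ring ^ 'n"
  by (simp add: dotp_def algebra_simps sum_subtractf)

lemma dotp_axis_right [simp]: "dotp x (axis i c) = x $ i * c"
  by (simp add: dotp_def axis_def if_distrib cong: if_cong)

lemma dotp_join_vec:
  "dotp (join_vec a b) (join_vec c d) = dotp a c + dotp b d"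
  unfolding dotp_def join_vec_def UNIV_Plus_UNIV [symmetric]
  by (simp add: sum.Plus del: UNIV_Plus_UNIV)

lemma join_vec_surj:
  obtains \<beta> \<gamma> where "\<alpha> = join_vec \<beta> \<gamma>"
proof
  show "\<alpha> = join_vec (\<chi> i. \<alpha> $ Inl i) (\<chi> j. \<alpha> $ Inr j)"
    by (auto simp: join_vec_def vec_eq_iff split: sum.split)
qed

lemma join_vec_eq_zero_iff [simp]: "join_vec \<beta> \<gamma> = 0 \<longleftrightarrow> \<beta> = 0 \<and> \<gamma> = 0"
proof -
  have "join_vec \<beta> \<gamma> $ Inl i = \<beta> $ i" "join_vec \<beta> \<gamma> $ Inr j = \<gamma> $ j" for i j
    by (simp_all add: join_vec_def)
  moreover have "join_vec 0 0 = 0"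
    by (simp add: join_vec_def vec_eq_iff split: sum.split)
  ultimately show ?thesis
    by (metis vec_eq_iff zero_index)
qed

text \<open>Two points of an affine hyperplane differ by a vector orthogonal to its normal
  \<open>w\<close>, so \<open>x\<close> annihilates all such vectors. Testing on
  \<open>e_j - (w_j / w_i) e_i\<close> with \<open>w_i\<close> nonzero forces
  proportionality.\<close>

lemma dotp_const_on_hyperplane:
  fixes x w :: "'q::field ^ 'n"
  assumes w: "w \<noteq> 0" and const: "\<And>y. dotp w y = c \<Longrightarrow> dotp x y = k"
  obtains a where "x = a *s w"
proof -
  obtain i where i: "w $ i \<noteq> 0"
    using w by (auto simp: vec_eq_iff)
  have "x $ j = (x $ i / w $ i) * w $ j" for j
  proof -
    \<comment> \<open>A point of the hyperplane; the next line shifts it by a vector orthogonal to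
      \<open>w\<close>, and the two values are compared.\<close>
    have base: "dotp x (axis i (c / w $ i)) = k"
      by (rule const) (simp add: i)
    have "dotp x (axis i (c / w $ i) + (axis j 1 + axis i (- (w $ j / w $ i)))) = k"
      by (rule const) (simp add: i dotp_add_right)
    then have "dotp x (axis j 1 + axis i (- (w $ j / w $ i))) = 0"
      unfolding dotp_add_right [of x "axis i (c / w $ i)"] base by (simp only: add_cancel_left_right)
    then have "x $ j - x $ i * (w $ j / w $ i) = 0"
      unfolding dotp_add_right dotp_axis_right by simp
    then show ?thesis
      by simp
  qed
  then have "x = (x $ i / w $ i) *s w"
    unfolding vec_eq_iff vector_smult_component by blast
  then show ?thesis ..
qed

lemma dotp_const_imp_zero:
  fixes x :: "'q::comm_ring_1 ^ 'n"
  assumes "\<And>y. dotp x y = k"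
  shows "x = 0"
proof -
  have "x $ i = 0" for i
    using assms [of 0] assms [of "axis i 1"] by simp
  then show ?thesis
    by (simp add: vec_eq_iff)
qed

section \<open>Vectors over the binary field\<close>

lemma obtain_distinct:
  fixes i :: 'a
  assumes "CARD('a) \<ge> 2"
  obtains j where "i \<noteq> j"
proof -
  have "\<exists>j. i \<noteq> j"
  proof (rule ccontr)
    assume "\<nexists>j. i \<noteq> j"
    then have "(UNIV :: 'a set) = {i}"
      by auto
    then have "CARD('a) = 1"
      by (metis One_nat_def card_1_singleton_iff)
    with assms show False
      by simp
  qed
  with that show ?thesis
    by blast
qed

text \<open>The difference \<open>x - v\<close> is a multiple of \<open>w\<close>, and the only
  scalars are 0 and 1.\<close>

lemma bit_dotp_affine_on_hyperplane:
  fixes x v w :: "bit ^ 'n"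
  assumes w: "w \<noteq> 0" and affine: "\<And>y. dotp w y = c \<Longrightarrow> dotp x y = dotp v y + k"
  shows "x = v \<or> x = v + w"
proof -
  have "dotp (x - v) y = k" if "dotp w y = c" for y
    using affine [OF that] by (simp add: dotp_diff_left)
  from dotp_const_on_hyperplane [OF w this] obtain a where "x - v = a *s w"
    by blast
  then have "x = v + a *s w"
    by (simp add: algebra_simps)
  then show ?thesis
    by (cases a) simp_all
qed

text \<open>The values of \<open>x\<close> at two unit vectors and at their sum add up to 0 in
  characteristic 2, so they cannot all be 1.\<close>

lemma obtain_nonzero_dotp_eq_zero:
  fixes x :: "bit ^ 'n"
  assumes "CARD('n) \<ge> 2"
  obtains y where "y \<noteq> 0" "dotp x y = 0"
proof -
  fix i :: 'n
  obtain j where ij: "i \<noteq> j"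
    by (rule obtain_distinct [OF assms])
  let ?i = "axis i 1 :: bit ^ 'n" and ?j = "axis j 1 :: bit ^ 'n"
  have nz: "?i \<noteq> 0" "?j \<noteq> 0" "?i + ?j \<noteq> 0"
    using ij by (auto simp: axis_eq_0_iff vec_eq_iff axis_def intro: exI [of _ i])
  have "dotp x ?i = 0 \<or> dotp x ?j = 0 \<or> dotp x (?i + ?j) = 0"
    by (cases "x $ i"; cases "x $ j") (simp_all add: dotp_add_right)
  with nz that show ?thesis
    by blast
qed

lemma wt_zero [simp]: "wt 0 = 0"
  by (simp add: wt_def supp_def)

lemma wt_axis [simp]: "wt (axis i (1::'q::zero_neq_one)) = 1"
proof -
  have "supp (axis i (1::'q)) = {i}"
    by (auto simp: supp_def axis_def)
  then show ?thesis
    by (simp add: wt_def)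
qed

lemma wt_axis_add_axis:
  assumes "i \<noteq> j"
  shows "wt (axis i 1 + axis j (1::'q::semiring_1)) = 2"
proof -
  have "supp (axis i 1 + axis j (1::'q)) = {i, j}"
    using assms by (auto simp: supp_def axis_def)
  then show ?thesis
    using assms by (simp add: wt_def)
qed

section \<open>The parameters of the code\<close>

lemma card_nonzero_vec:
  "CARD(('q::{finite, zero_neq_one}, 'm::finite) nonzero_vec) = CARD('q) ^ CARD('m) - 1"
proof -
  interpret type_definition "vec_of :: ('q, 'm) nonzero_vec \<Rightarrow> _" nonzero_vec_of "{\<alpha>. \<alpha> \<noteq> 0}"
    by (rule type_definition_nonzero_vec)
  have "{\<alpha> :: 'q ^ 'm. \<alpha> \<noteq> 0} = UNIV - {0}"
    by auto
  then show ?thesis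
    by (simp add: card card_Diff_subset)
qed

text \<open>\<open>indep\<close> says that the linear parametrization by \<open>(u, v)\<close> has
  trivial kernel, so the code inherits the dimension of its parameter space.\<close>

lemma linear_code_code_of:
  fixes f :: "'q::{field, finite} ^ 'm::finite \<Rightarrow> 'q"
  assumes indep: "\<And>u v. (\<And>\<alpha>. \<alpha> \<noteq> 0 \<Longrightarrow> u * f \<alpha> + dotp v \<alpha> = 0) \<Longrightarrow> u = 0 \<and> v = 0"
  shows "linear_code (CARD('q) ^ CARD('m) - 1) (CARD('m) + 1) CARD('q) (code_of f)"
proof -
  \<comment> \<open>The pair \<open>(u, v)\<close> is encoded as a single vector with \<open>u\<close> at position \<open>None\<close>.\<close>
  define F :: "'q ^ ('m option) \<Rightarrow> 'q ^ ('q, 'm) nonzero_vec" where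
    "F x = (\<chi> \<alpha>. x $ None * f (vec_of \<alpha>) + dotp (\<chi> i. x $ Some i) (vec_of \<alpha>))" for x
  have lin: "Vector_Spaces.linear (*s) (*s) F"
    by unfold_locales
      (simp_all add: F_def vec_eq_iff dotp_def algebra_simps sum.distrib sum_distrib_left)
  have range: "code_of f = range F"
  proof
    show "range F \<subseteq> code_of f"
      by (auto simp: code_of_def F_def)
    show "code_of f \<subseteq> range F"
    proof
      fix c assume "c \<in> code_of f"
      then obtain u v where c: "c = (\<chi> \<alpha>. u * f (vec_of \<alpha>) + dotp v (vec_of \<alpha>))"
        by (auto simp: code_of_def)
      have "c = F (\<chi> k. case k of None \<Rightarrow> u | Some i \<Rightarrow> v $ i)"
        by (simp add: c F_def)
      then show "c \<in> range F"
        by blast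
    qed
  qed
  have "inj F"
  proof (subst vec.linear_inj_iff_eq_0 [OF lin], intro allI impI)
    fix x assume x: "F x = 0"
    have "x $ None * f \<alpha> + dotp (\<chi> i. x $ Some i) \<alpha> = 0" if "\<alpha> \<noteq> 0" for \<alpha>
      using arg_cong [OF x, of "\<lambda>y. y $ nonzero_vec_of \<alpha>"] that
      by (simp add: F_def nonzero_vec_of_inverse)
    from indep [OF this] have "x $ k = 0" for k
      by (cases k) (simp_all add: vec_eq_iff)
    then show "x = 0"
      by (simp add: vec_eq_iff)
  qed
  then have "vec.dim (code_of f) = CARD('m) + 1"
    unfolding range by (subst vec.dim_image_eq [OF lin]) (simp_all add: vec_dim_card del: vec.dim_UNIV)
  moreover have "vec.subspace (code_of f)"
    unfolding range by (rule vec.linear_subspace_image [OF lin vec.subspace_UNIV])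
  ultimately show ?thesis
    by (simp add: linear_code_def card_nonzero_vec)
qed

text \<open>The multiples of a binary word are only 0 and the word itself, so an inclusion of
  supports must force \<open>b = 0\<close> or \<open>b = c\<close>. As nonzero means equal to 1, the
  inclusion is an implication between values.\<close>

lemma minimal_code_of_bitI:
  fixes f :: "bit ^ 'm::finite \<Rightarrow> bit"
  assumes incomparable: "\<And>u v u' v'.
    (\<And>\<alpha>. \<alpha> \<noteq> 0 \<Longrightarrow> u * f \<alpha> + dotp v \<alpha> = 1 \<Longrightarrow> u' * f \<alpha> + dotp v' \<alpha> = 1) \<Longrightarrow>
    (u = 0 \<and> v = 0) \<or> (u = u' \<and> v = v')"
  shows "minimal_code (code_of f)"
  unfolding minimal_code_def minimal_codeword_def
proof (intro ballI conjI impI)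
  fix b c assume c: "c \<in> code_of f" and b: "b \<in> code_of f" and sub: "supp b \<subseteq> supp c"
  obtain u v where b_eq: "b = (\<chi> \<alpha>. u * f (vec_of \<alpha>) + dotp v (vec_of \<alpha>))"
    using b by (auto simp: code_of_def)
  obtain u' v' where c_eq: "c = (\<chi> \<alpha>. u' * f (vec_of \<alpha>) + dotp v' (vec_of \<alpha>))"
    using c by (auto simp: code_of_def)
  have "u' * f \<alpha> + dotp v' \<alpha> = 1" if "\<alpha> \<noteq> 0" "u * f \<alpha> + dotp v \<alpha> = 1" for \<alpha>
    using subsetD [OF sub, of "nonzero_vec_of \<alpha>"] that
    by (simp add: supp_def b_eq c_eq nonzero_vec_of_inverse)
  from incomparable [OF this] have "b = 0 \<or> b = c"
  proof
    assume "u = 0 \<and> v = 0"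
    then have "b = 0"
      unfolding b_eq by (simp add: vec_eq_iff [of _ "0 :: _ ^ (_, _) nonzero_vec"])
    then show ?thesis ..
  next
    assume "u = u' \<and> v = v'"
    then have "b = c"
      by (simp only: b_eq c_eq)
    then show ?thesis ..
  qed
  then have "b = 0 *s c \<or> b = 1 *s c"
    by simp
  then show "\<exists>a. b = a *s c"
    by blast
qed

section \<open>Functions that are injective on the vectors of low weight\<close>

locale low_weight_injective =
  fixes \<phi> :: "bit ^ 's::finite \<Rightarrow> bit ^ 't::finite"
  assumes two_le_card: "CARD('s) \<ge> 2"
    and inj: "inj_on \<phi> {\<beta>. wt \<beta> \<le> 1}"
    and nonzero: "\<And>\<beta>. wt \<beta> \<le> 1 \<Longrightarrow> \<phi> \<beta> \<noteq> 0"
    and weight_two: "\<And>\<beta>. wt \<beta> = 2 \<Longrightarrow> \<phi> \<beta> = 0"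
begin

lemma axis_nonzero: "\<phi> (axis i 1) \<noteq> 0"
  by (rule nonzero) simp

lemma axis_eq_iff: "\<phi> (axis i 1) = \<phi> (axis j 1) \<longleftrightarrow> i = j"
  using inj_on_eq_iff [OF inj, of "axis i 1" "axis j 1"] by (simp add: axis_eq_axis)

lemma axis_noteq_zero: "\<phi> (axis i 1) \<noteq> \<phi> 0"
  using inj_on_eq_iff [OF inj, of "axis i 1" 0] by (simp add: axis_eq_0_iff)

text \<open>If \<open>w\<^sub>2\<close> is nonzero, \<open>\<phi>\<close> takes at most two values,
  against three distinct ones at 0 and two unit vectors. Otherwise \<open>\<phi>\<close> is constant
  where \<open>w\<^sub>1\<close> has value 1, a set with two points at which it must differ.\<close>

lemma not_affine_off_hyperplane:
  assumes w: "w\<^sub>1 \<noteq> 0 \<or> w\<^sub>2 \<noteq> 0"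
    and eq: "\<And>\<beta> \<gamma>. dotp w\<^sub>1 \<beta> + dotp w\<^sub>2 \<gamma> = 1 \<Longrightarrow> dotp (\<phi> \<beta>) \<gamma> = dotp v\<^sub>1 \<beta> + dotp v\<^sub>2 \<gamma> + k"
  shows False
proof (cases "w\<^sub>2 = 0")
  case False
  have two_values: "\<phi> \<beta> = v\<^sub>2 \<or> \<phi> \<beta> = v\<^sub>2 + w\<^sub>2" for \<beta>
  proof -
    have "dotp (\<phi> \<beta>) \<gamma> = dotp v\<^sub>2 \<gamma> + (dotp v\<^sub>1 \<beta> + k)" if "dotp w\<^sub>2 \<gamma> = 1 - dotp w\<^sub>1 \<beta>" for \<gamma>
      using eq [of \<beta> \<gamma>] that by (simp only:) (simp add: algebra_simps)
    from bit_dotp_affine_on_hyperplane [OF False this] show ?thesis .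
  qed
  fix i :: 's
  obtain j where "i \<noteq> j"
    by (rule obtain_distinct [OF two_le_card])
  then show False
    using two_values [of 0] two_values [of "axis i 1"] two_values [of "axis j 1"]
      axis_eq_iff [of i j] axis_noteq_zero [of i] axis_noteq_zero [of j] by metis
next
  case True
  then obtain i where i: "w\<^sub>1 $ i = 1"
    using w by (auto simp: vec_eq_iff)
  \<comment> \<open>Here the condition leaves \<gamma> free, so the form
    \<open>\<phi> \<beta> - v\<^sub>2\<close> is constant on the whole space.\<close>
  have fixed_value: "\<phi> \<beta> = v\<^sub>2" if "dotp w\<^sub>1 \<beta> = 1" for \<beta>
  proof -
    have "dotp (\<phi> \<beta> - v\<^sub>2) \<gamma> = dotp v\<^sub>1 \<beta> + k" for \<gamma>
      using eq [of \<beta> \<gamma>] that True by (simp add: dotp_diff_left)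
    then have "\<phi> \<beta> - v\<^sub>2 = 0"
      by (rule dotp_const_imp_zero)
    then show ?thesis
      by simp
  qed
  obtain j where ij: "i \<noteq> j"
    by (rule obtain_distinct [OF two_le_card])
  have "\<phi> (axis i 1) = v\<^sub>2"
    by (rule fixed_value) (simp add: i)
  \<comment> \<open>Since \<open>w\<^sub>1 $ i = 1\<close>, exactly one of these two points has
    \<open>w\<^sub>1\<close>-value 1. The first would contradict injectivity, the second would give
    \<open>\<phi> (axis i 1) = 0\<close>.\<close>
  moreover have "\<phi> (axis j 1) = v\<^sub>2 \<or> \<phi> (axis i 1 + axis j 1) = v\<^sub>2"
    using fixed_value [of "axis j 1"] fixed_value [of "axis i 1 + axis j 1"] i
    by (cases "w\<^sub>1 $ j") (simp_all add: dotp_add_right)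
  moreover have "\<phi> (axis i 1) \<noteq> \<phi> (axis j 1)"
    using ij by (simp add: axis_eq_iff)
  moreover have "\<phi> (axis i 1 + axis j 1) = 0"
    by (rule weight_two [OF wt_axis_add_axis [OF ij]])
  ultimately show False
    using axis_nonzero [of i] by simp
qed

text \<open>The origin is not a coordinate position, so a vector of weight two replaces 0 as the
  source of a third value. If \<open>w\<^sub>2 = 0\<close>, the slice \<open>\<beta> = 0\<close>
  suffices: a linear form in at least two binary variables has a nonzero zero.\<close>

lemma not_affine_on_hyperplane:
  assumes card_t: "CARD('t) \<ge> 2"
    and eq: "\<And>\<beta> \<gamma>. \<beta> \<noteq> 0 \<or> \<gamma> \<noteq> 0 \<Longrightarrow> dotp w\<^sub>1 \<beta> + dotp w\<^sub>2 \<gamma> = 0 \<Longrightarrow>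
      dotp (\<phi> \<beta>) \<gamma> = dotp v\<^sub>1 \<beta> + dotp v\<^sub>2 \<gamma> + 1"
  shows False
proof (cases "w\<^sub>2 = 0")
  case True
  obtain \<gamma> where "\<gamma> \<noteq> 0" "dotp (\<phi> 0 - v\<^sub>2) \<gamma> = 0"
    using obtain_nonzero_dotp_eq_zero [OF card_t] .
  then show False
    using eq [of 0 \<gamma>] True by (simp add: dotp_diff_left)
next
  case False
  \<comment> \<open>At \<open>\<beta> = 0\<close> the slice would lack the point
    \<open>\<gamma> = 0\<close> and not be a full hyperplane.\<close>
  have two_values: "\<phi> \<beta> = v\<^sub>2 \<or> \<phi> \<beta> = v\<^sub>2 + w\<^sub>2" if "\<beta> \<noteq> 0" for \<beta>
  proof -
    have "dotp (\<phi> \<beta>) \<gamma> = dotp v\<^sub>2 \<gamma> + (dotp v\<^sub>1 \<beta> + 1)" if "dotp w\<^sub>2 \<gamma> = - dotp w\<^sub>1 \<beta>" for \<gamma>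
      using eq [of \<beta> \<gamma>] that \<open>\<beta> \<noteq> 0\<close> by (simp only:) (simp add: algebra_simps)
    from bit_dotp_affine_on_hyperplane [OF False this] show ?thesis .
  qed
  fix i :: 's
  obtain j where ij: "i \<noteq> j"
    by (rule obtain_distinct [OF two_le_card])
  \<comment> \<open>Three distinct values \<open>0\<close>, \<open>\<phi> (axis i 1)\<close>, \<open>\<phi> (axis j 1)\<close> in a set of two elements.\<close>
  have wt2: "wt (axis i 1 + axis j (1::bit)) = 2"
    by (rule wt_axis_add_axis [OF ij])
  then have "axis i 1 + axis j (1::bit) \<noteq> 0"
    by (intro notI) simp
  from two_values [OF this] have "v\<^sub>2 = 0 \<or> v\<^sub>2 + w\<^sub>2 = 0"
    unfolding weight_two [OF wt2] by (simp only: eq_commute)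
  moreover have "\<phi> (axis l 1) = v\<^sub>2 \<or> \<phi> (axis l 1) = v\<^sub>2 + w\<^sub>2" for l
    by (rule two_values) (simp add: axis_eq_0_iff)
  moreover have "\<phi> (axis i 1) \<noteq> \<phi> (axis j 1)"
    using ij by (simp add: axis_eq_iff)
  ultimately show False
    using axis_nonzero [of i] axis_nonzero [of j] by metis
qed

end

section \<open>Maiorana-McFarland functions with constant offset 1\<close>

theorem theorem6p3:
  fixes s t m :: nat
    and \<phi> :: "bit ^ 's::finite \<Rightarrow> bit ^ 't::finite"
    and g :: "bit ^ 's \<Rightarrow> bit"
    and f :: "bit ^ ('s + 't) \<Rightarrow> bit"
    and U :: "(bit ^ 's) set"
  assumes "CARD('s) = s" and "s \<ge> 2"
    and "CARD('t) = t" and "t \<ge> 2"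
    and "m = s + t"
    and "\<And>\<beta> \<gamma>. f (join_vec \<beta> \<gamma>) = dotp (\<phi> \<beta>) \<gamma> + g \<beta>"
    and "U = {\<beta>. wt \<beta> \<le> 1}"
    and "inj_on \<phi> U" and "\<phi> ` U \<subseteq> UNIV - {0}"
    and "\<And>\<beta>. wt \<beta> = 2 \<Longrightarrow> \<phi> \<beta> = 0"
    and "\<And>\<beta>. g \<beta> = 1"
  shows "linear_code (2 ^ m - 1) (m + 1) 2 (code_of f) \<and> minimal_code (code_of f)"
proof
  interpret low_weight_injective \<phi>
  proof
    show "CARD('s) \<ge> 2"
      using assms(1,2) by simp
    show "inj_on \<phi> {\<beta>. wt \<beta> \<le> 1}"
      using assms(7,8) by simp
    show "\<phi> \<beta> \<noteq> 0" if "wt \<beta> \<le> 1" for \<beta>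
      using assms(7,9) that by blast
    show "\<phi> \<beta> = 0" if "wt \<beta> = 2" for \<beta>
      using assms(10) that .
  qed
  have card_t: "CARD('t) \<ge> 2"
    using assms(3,4) by simp
  have f: "f (join_vec \<beta> \<gamma>) = dotp (\<phi> \<beta>) \<gamma> + 1" for \<beta> \<gamma>
    by (simp only: assms(6,11))
  \<comment> \<open>Splitting \<open>w\<close> and \<open>v\<close> into blocks transfers the result
    on \<open>\<phi>\<close> to \<open>f\<close>; the value 1 of \<open>g\<close> turns
    \<open>k\<close> into \<open>k - 1\<close>.\<close>
  have off: False if "w \<noteq> 0" "\<And>\<alpha>. dotp w \<alpha> = 1 \<Longrightarrow> f \<alpha> = dotp v \<alpha> + k" for w v k
  proof -
    obtain w\<^sub>1 w\<^sub>2 where w: "w = join_vec w\<^sub>1 w\<^sub>2" by (rule join_vec_surj)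
    obtain v\<^sub>1 v\<^sub>2 where v: "v = join_vec v\<^sub>1 v\<^sub>2" by (rule join_vec_surj)
    have "w\<^sub>1 \<noteq> 0 \<or> w\<^sub>2 \<noteq> 0"
      using that(1) by (simp add: w)
    moreover have "dotp (\<phi> \<beta>) \<gamma> = dotp v\<^sub>1 \<beta> + dotp v\<^sub>2 \<gamma> + (k - 1)"
      if "dotp w\<^sub>1 \<beta> + dotp w\<^sub>2 \<gamma> = 1" for \<beta> \<gamma>
    proof -
      have "dotp (\<phi> \<beta>) \<gamma> + 1 = dotp v\<^sub>1 \<beta> + dotp v\<^sub>2 \<gamma> + k"
        using \<open>\<And>\<alpha>. dotp w \<alpha> = 1 \<Longrightarrow> f \<alpha> = dotp v \<alpha> + k\<close> [of "join_vec \<beta> \<gamma>"] that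
        by (simp only: w v f dotp_join_vec)
      then show ?thesis
        by (metis add_diff_cancel_right' add_diff_eq)
    qed
    ultimately show False
      by (rule not_affine_off_hyperplane)
  qed
  have on: False if "\<And>\<alpha>. \<alpha> \<noteq> 0 \<Longrightarrow> dotp w \<alpha> = 0 \<Longrightarrow> f \<alpha> = dotp v \<alpha>" for w v
  proof -
    obtain w\<^sub>1 w\<^sub>2 where w: "w = join_vec w\<^sub>1 w\<^sub>2" by (rule join_vec_surj)
    obtain v\<^sub>1 v\<^sub>2 where v: "v = join_vec v\<^sub>1 v\<^sub>2" by (rule join_vec_surj)
    show False
    proof (rule not_affine_on_hyperplane [OF card_t])
      fix \<beta> \<gamma> assume "\<beta> \<noteq> 0 \<or> \<gamma> \<noteq> 0" "dotp w\<^sub>1 \<beta> + dotp w\<^sub>2 \<gamma> = 0"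
      then have "dotp (\<phi> \<beta>) \<gamma> + 1 = dotp v\<^sub>1 \<beta> + dotp v\<^sub>2 \<gamma>"
        using that [of "join_vec \<beta> \<gamma>"] by (simp add: w v f dotp_join_vec)
      \<comment> \<open>Adding 1 to both sides moves the value of \<open>g\<close> to the right, as
        1 + 1 = 0.\<close>
      then show "dotp (\<phi> \<beta>) \<gamma> = dotp v\<^sub>1 \<beta> + dotp v\<^sub>2 \<gamma> + 1"
        by (cases "dotp (\<phi> \<beta>) \<gamma>") simp_all
    qed
  qed

  have indep: "u = 0 \<and> v = 0" if "\<And>\<alpha>. \<alpha> \<noteq> 0 \<Longrightarrow> u * f \<alpha> + dotp v \<alpha> = 0" for u v
  proof (cases u)
    case zero
    then have "dotp v \<alpha> = 0" for \<alpha>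
      using that [of \<alpha>] by (cases "\<alpha> = 0") simp_all
    with zero show ?thesis
      using dotp_const_imp_zero by blast
  next
    case one
    have "f \<alpha> = dotp v \<alpha>" if "\<alpha> \<noteq> 0" for \<alpha>
      using \<open>\<And>\<alpha>. \<alpha> \<noteq> 0 \<Longrightarrow> u * f \<alpha> + dotp v \<alpha> = 0\<close> [OF that] one
      by (cases "f \<alpha>"; cases "dotp v \<alpha>") simp_all
    \<comment> \<open>With normal 0 the hyperplane is the whole space.\<close>
    then show ?thesis
      using on [of 0 v] by blast
  qed
  have "CARD(bit) = 2"
  proof -
    have "(UNIV :: bit set) = {0, 1}"
      using bit_not_one_iff by blast
    from arg_cong [OF this, of card] show ?thesis
      by simp
  qed
  moreover have "CARD('s + 't) = m"
    using assms(1,3,5) by (simp add: card_UNIV_sum)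
  ultimately show "linear_code (2 ^ m - 1) (m + 1) 2 (code_of f)"
    using linear_code_code_of [of f, OF indep] by simp

  show "minimal_code (code_of f)"
  proof (rule minimal_code_of_bitI)
    fix u v u' v'
    assume imp: "\<And>\<alpha>. \<alpha> \<noteq> 0 \<Longrightarrow> u * f \<alpha> + dotp v \<alpha> = 1 \<Longrightarrow> u' * f \<alpha> + dotp v' \<alpha> = 1"
    show "(u = 0 \<and> v = 0) \<or> (u = u' \<and> v = v')"
    proof (cases u; cases u')
      assume u: "u = 0" "u' = 0"
      show ?thesis
      proof (cases "v = 0")
        case False
        \<comment> \<open>The form \<open>v'\<close> is constantly 1 where \<open>v\<close> is 1, so
          it is 0 or \<open>v\<close>; a unit vector then excludes 0.\<close>
        have *: "dotp v' \<alpha> = 1" if "dotp v \<alpha> = 1" for \<alpha>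
          using imp [of \<alpha>] that u by (cases "\<alpha> = 0") simp_all
        then have "v' = 0 \<or> v' = v"
          using bit_dotp_affine_on_hyperplane [OF False, of 1 v' 0 1] by simp
        moreover obtain i where "v $ i = 1"
          using False by (auto simp: vec_eq_iff)
        then have "v' \<noteq> 0"
          using * [of "axis i 1"] by auto
        ultimately show ?thesis
          using u by simp
      qed (use u in simp)
    next
      assume u: "u = 0" "u' = 1"
      have "f \<alpha> = dotp v' \<alpha> + 1" if "dotp v \<alpha> = 1" for \<alpha>
        using imp [of \<alpha>] that u
        by (cases "\<alpha> = 0"; cases "f \<alpha>"; cases "dotp v' \<alpha>") simp_all
      with off [of v v' 1] have "v = 0"
        by blast
      with u show ?thesis
        by simp
    next
      assume u: "u = 1" "u' = 0"
      \<comment> \<open>Where \<open>v'\<close> vanishes the larger word is 0, hence so is the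
        smaller one; \<open>on\<close> shows that this case cannot occur.\<close>
      have "f \<alpha> = dotp v \<alpha>" if "\<alpha> \<noteq> 0" "dotp v' \<alpha> = 0" for \<alpha>
        using imp [of \<alpha>] that u by (cases "f \<alpha>"; cases "dotp v \<alpha>") simp_all
      with on [of v' v] show ?thesis
        by blast
    next
      assume u: "u = 1" "u' = 1"
      \<comment> \<open>Where \<open>v\<close> and \<open>v'\<close> differ the two words differ, so
        the inclusion makes the smaller one 0 there.\<close>
      have "f \<alpha> = dotp v \<alpha> + 0" if "dotp (v - v') \<alpha> = 1" for \<alpha>
        using imp [of \<alpha>] that u
        by (cases "\<alpha> = 0"; cases "f \<alpha>"; cases "dotp v \<alpha>"; cases "dotp v' \<alpha>")
          (simp_all add: dotp_diff_left)
      with off [of "v - v'" v 0] have "v - v' = 0"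
        by blast
      with u show ?thesis
        by simp
    qed
  qed
qed

end
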